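(* Let $W=0$. Then all cuspless sub-Riemannian geodesics in $(SE(3),\Delta,\mathcal G_1)$ with $\lambda_6=0$ and $\lambda_1^2(0)+\lambda_2^2(0)+\lambda_3^2(0)\ne0$, departing from $e=(\mathbf 0,I)$, stay in the upper half space $z\ge0$.
   Context: $SE(3)=\mathbb R^3\rtimes SO(3)$; $\Delta=\mathrm{span}\{\mathcal A_3,\mathcal A_4,\mathcal A_5\}$ with $\mathcal A_3,\mathcal A_4,\mathcal A_5$ the left-invariant vector fields generating translation along the $z$-axis and rotations about the $x$- and $y$-axis, orthonormal for $\mathcal G_1$. Cuspless geodesics $\gamma=(\mathbf x,R)$ from $e$ with $\lambda_6=0$ (normalized $\lambda_3^2+\lambda_4^2+\lambda_5^2=1$), with spatial projection $\mathbf x=(x,y,z)$, are described in spatial arclength $s\in[0,s_{max}]$ as follows. The momentum is $\lambda_1(s)=\lambda_1(0)\cosh s-\lambda_5(0)\sinh s$, $\lambda_5(s)=\lambda_5(0)\cosh s-\lambda_1(0)\sinh s$, $\lambda_2(s)=\lambda_2(0)\cosh s+\lambda_4(0)\sinh s$, $\lambda_4(s)=\lambda_4(0)\cosh s+\lambda_2(0)\sinh s$, $\lambda_3(s)=\sqrt{1-\lambda_4(s)^2-\lambda_5(s)^2}$, with $\lambda_4(0)^2+\lambda_5(0)^2\le1$; $s_{max}\in(0,\infty]$ is the minimal $s>0$ with $\lambda_3(s)=0$; $\gamma(0)=(\mathbf 0,I)$ and for $0<s<s_{max}$ $$\mathbf x'(s)=R(s)\mathbf e_z,\qquad R'(s)=\frac1{\lambda_3(s)}R(s)\begin{pmatrix}0&0&\lambda_5(s)\\0&0&-\lambda_4(s)\\-\lambda_5(s)&\lambda_4(s)&0\end{pmatrix}.$$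 $W=-\lambda_1\lambda_4-\lambda_2\lambda_5$ is a first integral. *)

theory Defs
  imports "HOL-Analysis.Analysis"
begin

text \<open>
  The parameter \<open>p\<close> is the initial momentum \<open>(\<lambda>\<^sub>1(0), \<dots>, \<lambda>\<^sub>6(0))\<close>. The formulas below describe the
  momentum for \<open>p $ 6 = 0\<close>, in which case \<open>\<lambda>\<^sub>6\<close> vanishes identically.
\<close>

definition lam1 :: "real^6 \<Rightarrow> real \<Rightarrow> real" where
  "lam1 p s = p $ 1 * cosh s - p $ 5 * sinh s"

definition lam2 :: "real^6 \<Rightarrow> real \<Rightarrow> real" where
  "lam2 p s = p $ 2 * cosh s + p $ 4 * sinh s"

definition lam4 :: "real^6 \<Rightarrow> real \<Rightarrow> real" where
  "lam4 p s = p $ 4 * cosh s + p $ 2 * sinh s"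

definition lam5 :: "real^6 \<Rightarrow> real \<Rightarrow> real" where
  "lam5 p s = p $ 5 * cosh s - p $ 1 * sinh s"

definition lam3 :: "real^6 \<Rightarrow> real \<Rightarrow> real" where
  "lam3 p s = sqrt (1 - (lam4 p s)\<^sup>2 - (lam5 p s)\<^sup>2)"

definition W :: "real^6 \<Rightarrow> real \<Rightarrow> real" where
  "W p s = - lam1 p s * lam4 p s - lam2 p s * lam5 p s"

lemma W_first_integral: "W p s = W p 0"
proof -
  have "W p s = (- p $ 1 * p $ 4 - p $ 2 * p $ 5) * ((cosh s)\<^sup>2 - (sinh s)\<^sup>2)"
    unfolding W_def lam1_def lam2_def lam4_def lam5_def
    by (simp add: algebra_simps power2_eq_square)
  then show ?thesis
    by (simp add: W_def lam1_def lam2_def lam4_def lam5_def hyperbolic_pythagoras)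
qed

text \<open>
  The infimum is \<open>\<infinity>\<close> if \<open>\<lambda>\<^sub>3\<close> has no positive zero. The zeros do not accumulate, so otherwise
  it is the least positive zero.
\<close>

definition s_max :: "real^6 \<Rightarrow> ereal" where
  "s_max p = Inf {ereal s |s. s > 0 \<and> lam3 p s = 0}"

definition arclength_domain :: "real^6 \<Rightarrow> real set" where
  "arclength_domain p = {s. 0 \<le> s \<and> ereal s \<le> s_max p}"

definition SO3 :: "(real^3^3) set" where
  "SO3 = {R. orthogonal_matrix R \<and> det R = 1}"

definition SE3 :: "((real^3) \<times> (real^3^3)) set" where
  "SE3 = UNIV \<times> SO3"

definition rotation_generator :: "real^6 \<Rightarrow> real \<Rightarrow> real^3^3" where
  "rotation_generator p s =
     vector [vector [0, 0, lam5 p s],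
             vector [0, 0, - lam4 p s],
             vector [- lam5 p s, lam4 p s, 0]]"

text \<open>
  Cuspless geodesics from the identity with \<open>\<lambda>\<^sub>6 = 0\<close>, parametrised by spatial arclength.
  The bound on \<open>\<lambda>\<^sub>4\<^sup>2 + \<lambda>\<^sub>5\<^sup>2\<close> says that \<open>\<lambda>\<^sub>3\<close> is the square root of a nonnegative number. Since
  \<open>sqrt\<close> is total here, this is needed to discard the data with \<open>\<lambda>\<^sub>3(0) = 0\<close> for which
  \<open>\<lambda>\<^sub>4\<^sup>2 + \<lambda>\<^sub>5\<^sup>2\<close> exceeds 1 immediately after 0. In all other cases it holds automatically.
  The differential equation is singular where \<open>\<lambda>\<^sub>3 = 0\<close>, which may occur at both ends of
  the domain, so it is imposed in the interior, and the curve is continuous up to the ends.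
\<close>

definition cuspless_geodesic_lam6_zero ::
    "real^6 \<Rightarrow> (real \<Rightarrow> (real^3) \<times> (real^3^3)) \<Rightarrow> bool" where
  "cuspless_geodesic_lam6_zero p \<gamma> \<longleftrightarrow>
     p $ 6 = 0 \<and>
     p $ 3 \<ge> 0 \<and> (p $ 3)\<^sup>2 + (p $ 4)\<^sup>2 + (p $ 5)\<^sup>2 = 1 \<and>
     (\<forall>s\<in>arclength_domain p. (lam4 p s)\<^sup>2 + (lam5 p s)\<^sup>2 \<le> 1) \<and>
     (\<forall>s\<in>arclength_domain p. \<gamma> s \<in> SE3) \<and>
     continuous_on (arclength_domain p) \<gamma> \<and>
     \<gamma> 0 = (0, mat 1) \<and>
     (\<forall>s. 0 < s \<and> ereal s < s_max p \<longrightarrow>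
        ((\<lambda>t. fst (\<gamma> t)) has_vector_derivative snd (\<gamma> s) *v axis 3 1) (at s) \<and>
        ((\<lambda>t. snd (\<gamma> t)) has_vector_derivative
           (1 / lam3 p s) *\<^sub>R (snd (\<gamma> s) ** rotation_generator p s)) (at s))"

end

(*
  For W = 0 the curve is planar: (lam5, -lam4) = f n and (-lam1, -lam2) = f' n for a fixed unit
  vector n, where f = a cosh + b sinh, and n may be chosen with b >= 0. Conservation of spatial
  momentum gives C * z = lam3(0) * (integral of lam3) + b * (f - a) with C = b^2 + 1 - a^2 > 0.
  The second summand can only be negative if b < -a. In that case f >= a, hence lam3 >= lam3(0),
  on [0,b], so that the first summand is at least b * (1 - a^2) after time b, which
  compensates b * (f - a) >= -b * (1 + a).
*)
theory Submission
  imports Defs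
begin

text \<open>The function \<open>t * sinh t - cosh t\<close> is -1 at 0 and has the derivative
  \<open>t * cosh t\<close>, which is nonnegative for \<open>t\<close> \<ge> 0.\<close>

lemma cosh_minus_1_le: "cosh t - 1 \<le> t * sinh t" if "0 \<le> t" for t :: real
proof -
  have "0 * sinh 0 - cosh 0 \<le> t * sinh t - cosh t"
    using that
  proof (rule DERIV_nonneg_imp_increasing_open)
    fix x :: real assume "0 < x"
    have "((\<lambda>x. x * sinh x - cosh x) has_real_derivative x * cosh x) (at x)"
      by (auto intro!: derivative_eq_intros)
    then show "\<exists>y. ((\<lambda>x. x * sinh x - cosh x) has_real_derivative y) (at x) \<and> 0 \<le> y"
      using \<open>0 < x\<close> by (intro exI[of _ "x * cosh x"]) simp
  qed (intro continuous_intros)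
  then show ?thesis by simp
qed

text \<open>Scalar form of a planar geodesic: \<open>z\<close> is the height, \<open>w\<close> and
  \<open>r\<close> are the components of the third row of the rotation along the z-axis and along
  the fixed horizontal direction. The pair \<open>(r, w)\<close> turns at the rate
  \<open>f / sqrt (1 - f^2)\<close>. This may be singular at both ends, so derivatives are demanded
  only inside and continuity up to the ends.\<close>

lemma planar_height_nonneg:
  fixes z w r :: "real \<Rightarrow> real" and a b s :: real
  defines "f \<equiv> \<lambda>t. a * cosh t + b * sinh t"
  assumes s: "0 < s" and b: "0 \<le> b" and pos: "b\<^sup>2 + 1 - a\<^sup>2 > 0"
    and le1: "\<And>t. 0 \<le> t \<Longrightarrow> t \<le> s \<Longrightarrow> (f t)\<^sup>2 \<le> 1"
    and less1: "\<And>t. 0 < t \<Longrightarrow> t < s \<Longrightarrow> (f t)\<^sup>2 < 1"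
    and cont: "continuous_on {0..s} z" "continuous_on {0..s} w" "continuous_on {0..s} r"
    and init: "z 0 = 0" "w 0 = 1" "r 0 = 0"
    and dz: "\<And>t. 0 < t \<Longrightarrow> t < s \<Longrightarrow> (z has_real_derivative w t) (at t)"
    and dw: "\<And>t. 0 < t \<Longrightarrow> t < s \<Longrightarrow>
      (w has_real_derivative f t * r t / sqrt (1 - (f t)\<^sup>2)) (at t)"
    and dr: "\<And>t. 0 < t \<Longrightarrow> t < s \<Longrightarrow>
      (r has_real_derivative - f t * w t / sqrt (1 - (f t)\<^sup>2)) (at t)"
  shows "0 \<le> z s"
proof -
  \<comment> \<open>In the application \<open>g\<close> is \<open>lam3\<close>,
    \<open>(lam1, lam2)\<close> is \<open>- f'\<close> times the planar direction, and
    \<open>C\<close> is the squared length of the momentum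
    \<open>(lam1, lam2, lam3)\<close>.\<close>
  define f' where "f' t = a * sinh t + b * cosh t" for t
  define g where "g t = sqrt (1 - (f t)\<^sup>2)" for t
  define C where "C = b\<^sup>2 + 1 - a\<^sup>2"
  have f0: "f 0 = a" and f'0: "f' 0 = b" by (simp_all add: f_def f'_def)
  have df: "(f has_real_derivative f' t) (at t)" for t
    unfolding f_def f'_def by (auto intro!: derivative_eq_intros)
  have df': "(f' has_real_derivative f t) (at t)" for t
    unfolding f_def f'_def by (auto intro!: derivative_eq_intros)
  have g_pos: "0 < g t" if "0 < t" "t < s" for t
    using less1[OF that] by (simp add: g_def)
  have g_nonneg: "0 \<le> g t" if "0 \<le> t" "t \<le> s" for t
    using le1[OF that] by (simp add: g_def)
  have g_sq: "(g t)\<^sup>2 = 1 - (f t)\<^sup>2" if "0 \<le> t" "t \<le> s" for t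
    using le1[OF that] by (simp add: g_def)
  have dg: "(g has_real_derivative - f t * f' t / g t) (at t)" if t: "0 < t" "t < s" for t
  proof -
    have "((\<lambda>t. sqrt (1 - (f t)\<^sup>2)) has_real_derivative - f t * f' t / g t) (at t)"
      using less1[OF t] g_pos[OF t]
      by (auto intro!: derivative_eq_intros df simp: g_def field_simps)
    then show ?thesis by (simp add: g_def[abs_def])
  qed
  have contf: "continuous_on {0..s} f" "continuous_on {0..s} f'"
    unfolding f_def f'_def by (intro continuous_intros)+
  then have contg: "continuous_on {0..s} g"
    unfolding g_def by (intro continuous_intros)
  \<comment> \<open>The pair \<open>(g, f')\<close> obeys the same rotation equation as
    \<open>(r, w)\<close>. Hence the determinant of the two pairs (\<open>K1\<close>, the vertical
    component of the spatial momentum) and their inner product (\<open>K2\<close>) are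
    constant.\<close>
  have K1: "g t * w t - f' t * r t = g 0" if t: "0 \<le> t" "t \<le> s" for t
  proof -
    have "((\<lambda>t. g t * w t - f' t * r t) has_real_derivative 0) (at t)" if "0 < t" "t < s" for t
      using dw[OF that] dr[OF that] dg[OF that] df'[of t] g_pos[OF that]
      by (auto intro!: derivative_eq_intros simp flip: g_def simp: field_simps)
    moreover have "continuous_on {0..s} (\<lambda>t. g t * w t - f' t * r t)"
      by (intro continuous_intros cont contf contg)
    ultimately have "g t * w t - f' t * r t = g 0 * w 0 - f' 0 * r 0"
      using DERIV_isconst2[of 0 s "\<lambda>t. g t * w t - f' t * r t" t] s t by simp
    then show ?thesis by (simp add: init)
  qed
  have K2: "g t * r t + f' t * w t = b" if t: "0 \<le> t" "t \<le> s" for t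
  proof -
    have "((\<lambda>t. g t * r t + f' t * w t) has_real_derivative 0) (at t)" if "0 < t" "t < s" for t
      using dw[OF that] dr[OF that] dg[OF that] df'[of t] g_pos[OF that]
      by (auto intro!: derivative_eq_intros simp flip: g_def simp: field_simps)
    moreover have "continuous_on {0..s} (\<lambda>t. g t * r t + f' t * w t)"
      by (intro continuous_intros cont contf contg)
    ultimately have "g t * r t + f' t * w t = g 0 * r 0 + f' 0 * w 0"
      using DERIV_isconst2[of 0 s "\<lambda>t. g t * r t + f' t * w t" t] s t by simp
    then show ?thesis by (simp add: init f'0)
  qed
  have energy: "(f' t)\<^sup>2 - (f t)\<^sup>2 = b\<^sup>2 - a\<^sup>2" for t
  proof -
    have "(f' t)\<^sup>2 - (f t)\<^sup>2 = (b\<^sup>2 - a\<^sup>2) * ((cosh t)\<^sup>2 - (sinh t)\<^sup>2)"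
      unfolding f_def f'_def by (simp add: algebra_simps power2_eq_square)
    then show ?thesis by (simp add: hyperbolic_pythagoras)
  qed
  \<comment> \<open>\<open>K1\<close> and \<open>K2\<close> are a linear system for \<open>w\<close>
    and \<open>r\<close> with determinant \<open>g^2 + f'^2 = C\<close>; eliminating
    \<open>r\<close> leaves an expression for \<open>w\<close> that can be integrated.\<close>
  have w_eq: "C * w t = g t * g 0 + f' t * b" if t: "0 \<le> t" "t \<le> s" for t
  proof -
    have "C * w t = ((g t)\<^sup>2 + (f' t)\<^sup>2) * w t"
      using g_sq[OF t] energy[of t] by (simp add: C_def)
    also have "\<dots> = g t * (g t * w t - f' t * r t) + f' t * (g t * r t + f' t * w t)"
      by (simp add: algebra_simps power2_eq_square)
    finally show ?thesis using K1[OF t] K2[OF t] by simp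
  qed
  \<comment> \<open>\<open>h t\<close> represents \<open>g 0\<close> times the integral of
    \<open>g\<close> over \<open>[0, t]\<close>. Written as a difference, it needs only its
    derivative and no integral.\<close>
  define h where "h t = C * z t - b * (f t - a)" for t
  have dh: "(h has_real_derivative g t * g 0) (at t)" if t: "0 < t" "t < s" for t
  proof -
    have "C * w t - b * f' t = g t * g 0"
      using w_eq[of t] t by simp
    then show ?thesis
      unfolding h_def using dz[OF t] df[of t]
      by (auto intro!: derivative_eq_intros simp: mult.commute)
  qed
  have conth: "continuous_on {0..s} h"
    unfolding h_def by (intro continuous_intros cont contf)
  have h0: "h 0 = 0" by (simp add: h_def f0 init)
  have h_mono: "h t \<le> h u" if "0 \<le> t" "t \<le> u" "u \<le> s" for t u
  proof (rule DERIV_nonneg_imp_increasing_open[OF that(2)])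
    fix x assume "t < x" "x < u"
    then have "0 \<le> g x * g 0" using g_nonneg[of x] g_nonneg[of 0] that s by simp
    then show "\<exists>y. (h has_real_derivative y) (at x) \<and> 0 \<le> y"
      using dh[of x] that \<open>t < x\<close> \<open>x < u\<close> by auto
  next
    show "continuous_on {t..u} h"
      using conth by (rule continuous_on_subset) (use that in auto)
  qed
  have a2: "a\<^sup>2 \<le> 1" using le1[of 0] s f0 by simp
  then have a1: "- 1 \<le> a" using abs_square_le_1 abs_le_D2 by fastforce
  \<comment> \<open>From \<open>a\<close> \<ge> -1 follows \<open>f t - a\<close> \<ge>
    \<open>b * sinh t - (cosh t - 1)\<close>, and \<open>t\<close> \<le> \<open>b\<close> reduces
    the claim to \<open>cosh_minus_1_le\<close>.\<close>
  have f_ge: "a \<le> f t" if t: "0 \<le> t" "t \<le> b" for t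
  proof -
    have "- (cosh t - 1) \<le> a * (cosh t - 1)"
      using mult_right_mono[OF a1, of "cosh t - 1"] cosh_real_ge_1[of t] by simp
    moreover have "t * sinh t \<le> b * sinh t"
      using t by (intro mult_right_mono) auto
    ultimately have "0 \<le> a * (cosh t - 1) + b * sinh t"
      using cosh_minus_1_le[OF t(1)] by linarith
    then show ?thesis by (simp add: f_def algebra_simps)
  qed
  have "0 \<le> C * z s"
  proof (cases "a \<le> f s")
    case True
    then have "0 \<le> b * (f s - a)" using b by simp
    moreover have "0 \<le> h s" using h_mono[of 0 s] h0 s by simp
    ultimately show ?thesis by (simp add: h_def)
  next
    case False
    then have bs: "b < s" using f_ge[of s] s by force
    have exp_eq: "cosh t - sinh t = exp (- t)" for t :: real
      by (simp add: cosh_def sinh_def field_simps)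
    \<comment> \<open>Otherwise \<open>f s - a\<close> would be at least
      \<open>b * (1 - exp (- s))\<close>, hence nonnegative.\<close>
    have ba: "b < - a"
    proof (rule ccontr)
      assume "\<not> b < - a"
      then have "- b * (cosh s - 1) \<le> a * (cosh s - 1)"
        using cosh_real_ge_1[of s] by (intro mult_right_mono) auto
      moreover have "b * (cosh s - sinh s) \<le> b * 1"
        unfolding exp_eq using b s by (intro mult_left_mono) auto
      ultimately show False using False by (simp add: f_def algebra_simps)
    qed
    \<comment> \<open>Replacing \<open>b\<close> by the larger \<open>- a\<close> gives the upper
      bound \<open>a * exp (- t)\<close>, where \<open>a < 0\<close>. The sign is what turns
      \<open>a\<close> \<le> \<open>f t\<close> into a bound on the square of
      \<open>f t\<close>.\<close>
    have f_neg: "f t \<le> 0" if "0 \<le> t" for t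
    proof -
      have "b * sinh t \<le> - a * sinh t" using ba that by (intro mult_right_mono) auto
      moreover have "a * (cosh t - sinh t) \<le> 0"
        unfolding exp_eq using ba b by (intro mult_nonpos_nonneg) auto
      ultimately show ?thesis by (simp add: f_def algebra_simps)
    qed
    have g_ge: "g 0 \<le> g t" if t: "0 \<le> t" "t \<le> b" for t
    proof -
      have "(f t)\<^sup>2 \<le> a\<^sup>2"
        using f_ge[OF t] f_neg[OF t(1)] by (intro iffD1[OF abs_le_square_iff]) auto
      then show ?thesis by (simp add: g_def f0)
    qed
    \<comment> \<open>On \<open>(0, b)\<close> the slope of \<open>h\<close> is at least
      \<open>(g 0)^2 = 1 - a^2\<close>.\<close>
    have "h 0 - (g 0)\<^sup>2 * 0 \<le> h b - (g 0)\<^sup>2 * b"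
    proof (rule DERIV_nonneg_imp_increasing_open[OF b])
      fix x assume x: "0 < x" "x < b"
      have "((\<lambda>t. h t - (g 0)\<^sup>2 * t) has_real_derivative g x * g 0 - (g 0)\<^sup>2) (at x)"
        using dh[of x] x bs by (auto intro!: derivative_eq_intros)
      moreover have "0 \<le> g x * g 0 - (g 0)\<^sup>2"
        using mult_right_mono[OF g_ge[of x] g_nonneg[of 0]] x s by (simp add: power2_eq_square)
      ultimately show "\<exists>y. ((\<lambda>t. h t - (g 0)\<^sup>2 * t) has_real_derivative y) (at x) \<and> 0 \<le> y"
        by blast
    next
      have "continuous_on {0..b} h"
        using conth by (rule continuous_on_subset) (use bs in auto)
      then show "continuous_on {0..b} (\<lambda>t. h t - (g 0)\<^sup>2 * t)"
        by (intro continuous_intros)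
    qed
    then have "b * (1 - a\<^sup>2) \<le> h b"
      using g_sq[of 0] s by (simp add: h0 f0 mult.commute)
    also have "h b \<le> h s" using h_mono[of b s] b bs by simp
    finally have *: "b * (1 - a\<^sup>2) \<le> h s" .
    have "- 1 \<le> f s" using le1[of s] s abs_square_le_1[of "f s"] by simp
    then have "b * (- 1 - a) \<le> b * (f s - a)"
      using b by (intro mult_left_mono) auto
    \<comment> \<open>This is the sum of the two lower bounds \<open>b * (1 - a^2)\<close> and
      \<open>- b * (1 + a)\<close>; it is nonnegative since -1 \<le> \<open>a\<close> < 0.\<close>
    moreover have "0 \<le> b * ((- a) * (1 + a))"
      using b ba a1 by (intro mult_nonneg_nonneg) auto
    ultimately show ?thesis
      using * by (simp add: h_def algebra_simps power2_eq_square)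
  qed
  then show ?thesis
    using pos by (simp add: C_def zero_le_mult_iff)
qed

text \<open>Vanishing of \<open>W\<close> means that the determinant of
  \<open>(p $ 1, p $ 2)\<close> and \<open>(p $ 5, - p $ 4)\<close> is zero, so both lie on one
  line, spanned by a unit vector \<open>(m, n)\<close>. Pointing it against
  \<open>(p $ 1, p $ 2)\<close> makes \<open>b\<close> nonnegative.\<close>

lemma planar_momentum:
  assumes "W p 0 = 0"
  obtains a b m n where "0 \<le> b" "m\<^sup>2 + n\<^sup>2 = 1"
    "p $ 5 = a * m" "p $ 4 = - a * n" "p $ 1 = - b * m" "p $ 2 = - b * n"
proof -
  have W0: "p $ 1 * p $ 4 + p $ 2 * p $ 5 = 0"
    using assms by (simp add: W_def lam1_def lam2_def lam4_def lam5_def)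
  show ?thesis
  proof (cases "p $ 1 = 0 \<and> p $ 2 = 0")
    case True
    define a where "a = sqrt ((p $ 5)\<^sup>2 + (p $ 4)\<^sup>2)"
    show ?thesis
    proof (cases "a = 0")
      case a: True
      then have "p $ 4 = 0" "p $ 5 = 0" by (auto simp: a_def add_nonneg_eq_0_iff)
      \<comment> \<open>Both vectors vanish, so any unit vector serves.\<close>
      then show ?thesis using True that[of 0 1 0 0] by simp
    next
      case a: False
      have "a\<^sup>2 = (p $ 5)\<^sup>2 + (p $ 4)\<^sup>2" by (simp add: a_def)
      moreover have "(p $ 5 / a)\<^sup>2 + (- p $ 4 / a)\<^sup>2 = ((p $ 5)\<^sup>2 + (p $ 4)\<^sup>2) / a\<^sup>2"
        by (simp add: power_divide add_divide_distrib)
      ultimately have "(p $ 5 / a)\<^sup>2 + (- p $ 4 / a)\<^sup>2 = 1"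
        using a by auto
      then show ?thesis using True a that[of 0 "p $ 5 / a" "- p $ 4 / a" a] by simp
    qed
  next
    case False
    define b where "b = sqrt ((p $ 1)\<^sup>2 + (p $ 2)\<^sup>2)"
    have b2: "b\<^sup>2 = (p $ 1)\<^sup>2 + (p $ 2)\<^sup>2" by (simp add: b_def)
    have b: "b > 0" using False by (auto simp: b_def sum_power2_gt_zero_iff)
    \<comment> \<open>The inner product of \<open>(p $ 5, - p $ 4)\<close> with the unit vector
      \<open>- (p $ 1, p $ 2) / b\<close>.\<close>
    define a where "a = (p $ 4 * p $ 2 - p $ 5 * p $ 1) / b"
    have "b\<^sup>2 * p $ 5 = - (p $ 4 * p $ 2 - p $ 5 * p $ 1) * p $ 1"
      unfolding b2 using W0 by algebra
    then have "p $ 5 = a * (- p $ 1 / b)"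
      using b by (simp add: a_def field_simps power2_eq_square)
    moreover have "b\<^sup>2 * p $ 4 = (p $ 4 * p $ 2 - p $ 5 * p $ 1) * p $ 2"
      unfolding b2 using W0 by algebra
    then have "p $ 4 = - a * (- p $ 2 / b)"
      using b by (simp add: a_def field_simps power2_eq_square)
    moreover have "(- p $ 1 / b)\<^sup>2 + (- p $ 2 / b)\<^sup>2 = ((p $ 1)\<^sup>2 + (p $ 2)\<^sup>2) / b\<^sup>2"
      by (simp add: power_divide add_divide_distrib)
    then have "(- p $ 1 / b)\<^sup>2 + (- p $ 2 / b)\<^sup>2 = 1"
      using b b2 by auto
    ultimately show ?thesis
      using b that[of b "- p $ 1 / b" "- p $ 2 / b" a] by simp
  qed
qed

theorem corollary7:
  fixes p :: "real^6" and \<gamma> :: "real \<Rightarrow> (real^3) \<times> (real^3^3)"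
  assumes "cuspless_geodesic_lam6_zero p \<gamma>"
    and "W p 0 = 0"
    and "(p $ 1)\<^sup>2 + (p $ 2)\<^sup>2 + (p $ 3)\<^sup>2 \<noteq> 0"
  shows "\<forall>s\<in>arclength_domain p. fst (\<gamma> s) $ 3 \<ge> 0"
proof
  fix s assume s: "s \<in> arclength_domain p"
  note geo = assms(1)[unfolded cuspless_geodesic_lam6_zero_def]
  have norm: "(p $ 3)\<^sup>2 + (p $ 4)\<^sup>2 + (p $ 5)\<^sup>2 = 1" and init: "\<gamma> 0 = (0, mat 1)"
    and bound: "\<And>s. s \<in> arclength_domain p \<Longrightarrow> (lam4 p s)\<^sup>2 + (lam5 p s)\<^sup>2 \<le> 1"
    and cont: "continuous_on (arclength_domain p) \<gamma>"
    and dx: "\<And>s. 0 < s \<Longrightarrow> ereal s < s_max p \<Longrightarrow>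
      ((\<lambda>t. fst (\<gamma> t)) has_vector_derivative snd (\<gamma> s) *v axis 3 1) (at s)"
    and dR: "\<And>s. 0 < s \<Longrightarrow> ereal s < s_max p \<Longrightarrow>
      ((\<lambda>t. snd (\<gamma> t)) has_vector_derivative
           (1 / lam3 p s) *\<^sub>R (snd (\<gamma> s) ** rotation_generator p s)) (at s)"
    using geo by auto
  obtain a b m n where b: "0 \<le> b" and mn: "m\<^sup>2 + n\<^sup>2 = 1"
    and p: "p $ 5 = a * m" "p $ 4 = - a * n" "p $ 1 = - b * m" "p $ 2 = - b * n"
    by (rule planar_momentum[OF assms(2)])
  define f where "f t = a * cosh t + b * sinh t" for t
  have l5: "lam5 p t = f t * m" and l4: "lam4 p t = - f t * n" for t
    by (simp_all add: lam4_def lam5_def p f_def algebra_simps)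
  have l45: "(lam4 p t)\<^sup>2 + (lam5 p t)\<^sup>2 = (f t)\<^sup>2" for t
  proof -
    have "(lam4 p t)\<^sup>2 + (lam5 p t)\<^sup>2 = (f t)\<^sup>2 * (m\<^sup>2 + n\<^sup>2)"
      by (simp add: l4 l5 power_mult_distrib algebra_simps)
    then show ?thesis by (simp add: mn)
  qed
  have l3: "lam3 p t = sqrt (1 - (f t)\<^sup>2)" for t
    unfolding l45[symmetric] lam3_def by (simp add: algebra_simps)
  show "fst (\<gamma> s) $ 3 \<ge> 0"
  proof (cases "s = 0")
    case True
    then show ?thesis by (simp add: init)
  next
    case False
    then have s0: "0 < s" and s_le: "ereal s \<le> s_max p"
      using s by (auto simp: arclength_domain_def)
    have dom: "{0..s} \<subseteq> arclength_domain p"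
      using s_le by (auto simp: arclength_domain_def intro: order_trans[of _ "ereal s"])
    have le1: "(f t)\<^sup>2 \<le> 1" if "0 \<le> t" "t \<le> s" for t
      using bound[of t] that dom by (simp add: l45 subset_iff)
    have inner: "ereal t < s_max p" if "t < s" for t
      using that s_le less_le_trans[of "ereal t" "ereal s"] by simp
    \<comment> \<open>Equality would make \<open>t\<close> a positive zero of \<open>lam3\<close>
      below \<open>s\<close>, contradicting \<open>s\<close> \<le> \<open>s_max p\<close>.\<close>
    have less1: "(f t)\<^sup>2 < 1" if t: "0 < t" "t < s" for t
    proof (rule ccontr)
      assume "\<not> (f t)\<^sup>2 < 1"
      then have "lam3 p t = 0" using le1[of t] t by (simp add: l3)
      then have "s_max p \<le> ereal t" unfolding s_max_def using t by (intro Inf_lower) auto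
      then show False using inner[OF t(2)] by simp
    qed
    have f0: "(f 0)\<^sup>2 = a\<^sup>2" by (simp add: f_def)
    have p12: "(p $ 1)\<^sup>2 + (p $ 2)\<^sup>2 = b\<^sup>2"
    proof -
      have "(p $ 1)\<^sup>2 + (p $ 2)\<^sup>2 = b\<^sup>2 * (m\<^sup>2 + n\<^sup>2)"
        by (simp add: p power_mult_distrib algebra_simps)
      then show ?thesis by (simp add: mn)
    qed
    have "(p $ 4)\<^sup>2 + (p $ 5)\<^sup>2 = a\<^sup>2"
      using l45[of 0] f0 by (simp add: lam4_def lam5_def)
    then have "b\<^sup>2 + 1 - a\<^sup>2 = (p $ 1)\<^sup>2 + (p $ 2)\<^sup>2 + (p $ 3)\<^sup>2"
      using p12 norm by simp
    \<comment> \<open>The nonvanishing of the initial linear momentum enters here and makes the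
      constant strictly positive.\<close>
    then have pos: "b\<^sup>2 + 1 - a\<^sup>2 > 0"
      using assms(3) by (smt (verit) zero_le_power2)
    \<comment> \<open>The third row determines the height, and right multiplication by the generator
      lets each row evolve by itself.\<close>
    define R where "R i t = snd (\<gamma> t) $ 3 $ i" for i t
    have contR: "continuous_on {0..s} (R i)" for i
      unfolding R_def by (intro continuous_intros continuous_on_subset[OF cont dom])
    have gen: "(1 / lam3 p t) *\<^sub>R (A ** rotation_generator p t) $ 3 $ i =
        (\<Sum>j\<in>UNIV. A $ 3 $ j * rotation_generator p t $ j $ i) / lam3 p t"
      for A :: "real^3^3" and t i
      by (simp add: matrix_matrix_mult_def)
    have dRi: "(R i has_real_derivative
        (\<Sum>j\<in>UNIV. R j t * rotation_generator p t $ j $ i) / lam3 p t) (at t)"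
      if t: "0 < t" "t < s" for t i
      unfolding R_def gen[symmetric] has_real_derivative_iff_has_vector_derivative
      using bounded_linear.has_vector_derivative[OF bounded_linear_vec_nth,
          OF bounded_linear.has_vector_derivative[OF bounded_linear_vec_nth,
            OF dR[OF t(1) inner[OF t(2)]]], of 3 i] by simp
    show ?thesis
    proof (rule planar_height_nonneg[OF s0 b pos, folded f_def,
        where z = "\<lambda>t. fst (\<gamma> t) $ 3" and w = "R 3"
          and r = "\<lambda>t. m * R 1 t + n * R 2 t"])
      show "continuous_on {0..s} (\<lambda>t. fst (\<gamma> t) $ 3)"
        by (intro continuous_intros continuous_on_subset[OF cont dom])
      show "continuous_on {0..s} (\<lambda>t. m * R 1 t + n * R 2 t)"
        by (intro continuous_intros contR)
      show "fst (\<gamma> 0) $ 3 = 0" "R 3 0 = 1" "m * R 1 0 + n * R 2 0 = 0"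
        by (simp_all add: init R_def mat_def)
    next
      fix t assume t: "0 < t" "t < s"
      have "(snd (\<gamma> t) *v axis 3 1) $ 3 = R 3 t"
        by (simp add: R_def matrix_vector_mult_basis column_def)
      then show "((\<lambda>t. fst (\<gamma> t) $ 3) has_real_derivative R 3 t) (at t)"
        using bounded_linear.has_vector_derivative[OF bounded_linear_vec_nth,
            OF dx[OF t(1) inner[OF t(2)]], of 3]
        by (simp add: has_real_derivative_iff_has_vector_derivative)
      show "(R 3 has_real_derivative f t * (m * R 1 t + n * R 2 t) / sqrt (1 - (f t)\<^sup>2)) (at t)"
        using dRi[OF t, of 3]
        by (simp add: sum_3 rotation_generator_def l3 l4 l5 algebra_simps)
      \<comment> \<open>The derivatives of \<open>R 1\<close> and \<open>R 2\<close> are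
        proportional to \<open>m\<close> and \<open>n\<close>, so their combination along the unit
        vector \<open>(m, n)\<close> loses all dependence on the direction.\<close>
      have "m * (- (R 3 t * (f t * m)) / lam3 p t) + n * (- (R 3 t * (f t * n)) / lam3 p t) =
          - f t * R 3 t * (m\<^sup>2 + n\<^sup>2) / lam3 p t"
        by (simp add: divide_inverse algebra_simps power2_eq_square)
      then have eq: "m * (- (R 3 t * (f t * m)) / lam3 p t) + n * (- (R 3 t * (f t * n)) / lam3 p t) =
          - f t * R 3 t / sqrt (1 - (f t)\<^sup>2)"
        by (simp add: mn l3)
      have "(R 1 has_real_derivative - (R 3 t * (f t * m)) / lam3 p t) (at t)"
        "(R 2 has_real_derivative - (R 3 t * (f t * n)) / lam3 p t) (at t)"
        using dRi[OF t, of 1] dRi[OF t, of 2]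
        by (simp_all add: sum_3 rotation_generator_def l4 l5)
      then show "((\<lambda>t. m * R 1 t + n * R 2 t) has_real_derivative
          - f t * R 3 t / sqrt (1 - (f t)\<^sup>2)) (at t)"
        unfolding eq[symmetric] by (intro DERIV_add DERIV_cmult)
    qed (use le1 less1 contR in auto)
  qed
qed

end
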